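(* Let $X$ be a real or complex Banach space, $c>0$, and let $S$ be a power bounded operator on $X$, that is, $\sup_{n\in\mathbb{Z}_+}\|S^n\|<\infty$. Then $T=(c+1)I+cS$ is not $1$-weakly hypercyclic.
   Context: An operator $T$ on a Banach space $X$ over $\mathbb{K}$ is $1$-weakly hypercyclic if there is $x\in X$ such that for every non-zero continuous linear functional $f$ on $X$, the set $\{f(T^mx):m\in\mathbb{Z}_+\}$ is dense in $\mathbb{K}$. *)

theory Defs
  imports "HOL-Analysis.Analysis"
begin

definition one_weakly_hypercyclic_real :: "('a::real_normed_vector \<Rightarrow> 'a) \<Rightarrow> bool" where
  "one_weakly_hypercyclic_real T \<longleftrightarrow>
     (\<exists>x. \<forall>f :: 'a \<Rightarrow> real. bounded_linear f \<and> f \<noteq> (\<lambda>_. 0) \<longrightarrow>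
            closure (range (\<lambda>m::nat. f ((T ^^ m) x))) = UNIV)"

text \<open>Complex structure on a real Banach space: a complex scalar multiplication extending
  the real one, with norm (a x) = |a| * norm x. A type 'a::banach together with such an sc is
  exactly a complex Banach space.\<close>
definition complex_scaling :: "(complex \<Rightarrow> 'a::real_normed_vector \<Rightarrow> 'a) \<Rightarrow> bool" where
  "complex_scaling sc \<longleftrightarrow>
     (\<forall>a x y. sc a (x + y) = sc a x + sc a y) \<and>
     (\<forall>a b x. sc (a + b) x = sc a x + sc b x) \<and>
     (\<forall>a b x. sc a (sc b x) = sc (a * b) x) \<and>
     (\<forall>r x. sc (complex_of_real r) x = r *\<^sub>R x) \<and>
     (\<forall>a x. norm (sc a x) = cmod a * norm x)"

definition complex_linear :: "(complex \<Rightarrow> 'a \<Rightarrow> 'a) \<Rightarrow> (complex \<Rightarrow> 'b \<Rightarrow> 'b)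
    \<Rightarrow> ('a \<Rightarrow> 'b) \<Rightarrow> bool" where
  "complex_linear sc sc' f \<longleftrightarrow> (\<forall>a x. f (sc a x) = sc' a (f x))"

definition one_weakly_hypercyclic_complex ::
    "(complex \<Rightarrow> 'a::real_normed_vector \<Rightarrow> 'a) \<Rightarrow> ('a \<Rightarrow> 'a) \<Rightarrow> bool" where
  "one_weakly_hypercyclic_complex sc T \<longleftrightarrow>
     (\<exists>x. \<forall>f :: 'a \<Rightarrow> complex.
            bounded_linear f \<and> complex_linear sc (*) f \<and> f \<noteq> (\<lambda>_. 0) \<longrightarrow>
            closure (range (\<lambda>m::nat. f ((T ^^ m) x))) = UNIV)"

end

theory Submission
  imports Defs "HOL-Probability.Infinite_Product_Measure"
begin

text \<open>
  Put \<open>R = - S\<close> and \<open>q = c / (1 + c)\<close>, so that \<open>(1 - q) T + q R\<close> is the identity. Renorm the space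
  so that \<open>R\<close> is a contraction; then \<open>T\<close> does not decrease norms. Expanding the \<open>n\<close>-th power of the
  identity binomially expresses \<open>T x - R x\<close> through the vectors \<open>R ^ k (T ^ (n - k) x)\<close> with
  coefficients whose absolute sum is, by the variance of the binomial distribution, at most
  \<open>1 / sqrt (n q (1 - q))\<close>. Hence \<open>T ^ n x\<close> grows at least like \<open>sqrt n\<close> times \<open>(T - R) x\<close>, and by
  iteration like \<open>n ^ 4\<close> unless \<open>(T - R) ^ 8 x = 0\<close>, in which case power boundedness forces \<open>T x = x\<close>.
  For an orbit growing that fast, a random combination of norming functionals stays away from \<open>0\<close>
  on the whole orbit with positive probability, so the orbit's image is not dense. The complex case
  follows because a complex functional is at least as large in modulus as its real part.
\<close>

subsection \<open>Norming functionals\<close>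

definition sublinear :: "('a::real_vector \<Rightarrow> real) \<Rightarrow> bool" where
  "sublinear p \<longleftrightarrow>
     (\<forall>x y. p (x + y) \<le> p x + p y) \<and> (\<forall>t x. t > 0 \<longrightarrow> p (t *\<^sub>R x) = t * p x)"

lemma sublinearI:
  assumes "\<And>x y. p (x + y) \<le> p x + p y" "\<And>t x. t > 0 \<Longrightarrow> p (t *\<^sub>R x) = t * p x"
  shows "sublinear p"
  using assms by (auto simp: sublinear_def)

lemma sublinear_add: "sublinear p \<Longrightarrow> p (x + y) \<le> p x + p y"
  by (simp add: sublinear_def)

lemma sublinear_scaleR: "sublinear p \<Longrightarrow> t > 0 \<Longrightarrow> p (t *\<^sub>R x) = t * p x"
  by (simp add: sublinear_def)

lemma sublinear_zero:
  assumes "sublinear p" shows "p 0 = 0"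
  using sublinear_scaleR[OF assms, of 2 0] by simp

lemma sublinear_minus:
  assumes "sublinear p" shows "- p (- x) \<le> p x"
  using sublinear_add[OF assms, of x "- x"] sublinear_zero[OF assms] by simp

lemma INF_positive_homogeneous:
  fixes g :: "'b \<Rightarrow> real"
  assumes "A \<noteq> {}" "bdd_below (g ` A)" "t > 0"
  shows "(INF a\<in>A. t * g a) = t * (INF a\<in>A. g a)"
proof (rule antisym)
  obtain m where m: "\<And>a. a \<in> A \<Longrightarrow> m \<le> g a"
    using assms(2) by (auto simp: bdd_below_def)
  have bdd: "bdd_below ((\<lambda>a. t * g a) ` A)"
    using m assms(3) by (intro bdd_belowI2[of _ "t * m"]) simp
  have "(INF a\<in>A. t * g a) / t \<le> (INF a\<in>A. g a)"
    using assms(1,3) cINF_lower[OF bdd]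
    by (intro cINF_greatest) (auto simp: field_simps)
  then show "(INF a\<in>A. t * g a) \<le> t * (INF a\<in>A. g a)"
    using assms(3) by (simp add: field_simps)
  show "t * (INF a\<in>A. g a) \<le> (INF a\<in>A. t * g a)"
    using assms by (intro cINF_greatest mult_left_mono cINF_lower) auto
qed

text \<open>Supplies the lower bounds of chains for Zorn's lemma. The infimum is finite because
  \<open>- p0 (- x)\<close> bounds every member from below, and subadditive because, of two members
  of a chain, the smaller one can stand in for both.\<close>

lemma sublinear_INF_chain:
  assumes "C \<noteq> {}" and sub: "\<And>p. p \<in> C \<Longrightarrow> sublinear p"
    and le: "\<And>p x. p \<in> C \<Longrightarrow> p x \<le> p0 x"
    and chain: "\<And>p q. p \<in> C \<Longrightarrow> q \<in> C \<Longrightarrow> p \<le> q \<or> q \<le> p"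
  shows "bdd_below ((\<lambda>p. p x) ` C)" and "sublinear (\<lambda>x. INF p\<in>C. p x)"
proof -
  show bdd: "bdd_below ((\<lambda>p. p x) ` C)" for x
  proof (rule bdd_belowI2)
    fix p assume "p \<in> C"
    then show "- p0 (- x) \<le> p x"
      using sublinear_minus[OF sub, of p x] le[of p "- x"] by linarith
  qed
  show "sublinear (\<lambda>x. INF p\<in>C. p x)"
  proof (rule sublinearI)
    fix x y
    have "(INF p\<in>C. p (x + y)) \<le> r x + s y" if rs: "r \<in> C" "s \<in> C" for r s
    proof -
      obtain u where u: "u \<in> C" "u \<le> r" "u \<le> s"
        using chain[OF rs] rs by blast
      have "(INF p\<in>C. p (x + y)) \<le> u (x + y)"
        by (rule cINF_lower[OF bdd u(1)])
      also have "\<dots> \<le> u x + u y"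
        by (rule sublinear_add[OF sub[OF u(1)]])
      also have "\<dots> \<le> r x + s y"
        using u by (intro add_mono) (auto simp: le_fun_def)
      finally show ?thesis .
    qed
    then have "(INF p\<in>C. p (x + y)) - s y \<le> (INF p\<in>C. p x)" if "s \<in> C" for s
      using assms(1) that by (intro cINF_greatest) (auto simp: algebra_simps)
    then have "(INF p\<in>C. p (x + y)) - (INF p\<in>C. p x) \<le> (INF p\<in>C. p y)"
      using assms(1) by (intro cINF_greatest) (auto simp: algebra_simps)
    then show "(INF p\<in>C. p (x + y)) \<le> (INF p\<in>C. p x) + (INF p\<in>C. p y)"
      by simp
  next
    fix t :: real and x assume t: "t > 0"
    have "(INF p\<in>C. p (t *\<^sub>R x)) = (INF p\<in>C. t * p x)"
      using sublinear_scaleR[OF sub t] by (intro INF_cong) auto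
    then show "(INF p\<in>C. p (t *\<^sub>R x)) = t * (INF p\<in>C. p x)"
      using INF_positive_homogeneous[OF assms(1) bdd t] by simp
  qed
qed

text \<open>\<open>q x\<close> is the infimum of \<open>p (x + t y) - t p y\<close> over
  \<open>t \<ge> 0\<close>; the parameter \<open>0\<close> gives \<open>q \<le> p\<close>, and the
  parameter \<open>1\<close> at \<open>- y\<close> gives the last claim. Applied to a minimal
  functional this forces oddness; applied to the norm it prescribes the value of a functional at
  \<open>y\<close>.\<close>

lemma sublinear_reduce:
  fixes p :: "'a::real_vector \<Rightarrow> real"
  assumes p: "sublinear p"
  obtains q where "sublinear q" "\<And>x. q x \<le> p x" "q (- y) \<le> - p y"
proof -
  define h where "h x t = p (x + t *\<^sub>R y) - t * p y" for x t
  define q where "q x = (INF t\<in>{0..}. h x t)" for x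
  have scale: "p (t *\<^sub>R y) = t * p y" if "t \<ge> 0" for t
    using that sublinear_scaleR[OF p] sublinear_zero[OF p] by (cases "t = 0") auto
  \<comment> \<open>Subadditivity for \<open>t y = (x + t y) + (- x)\<close> keeps the infimum
    finite.\<close>
  have "- p (- x) \<le> h x t" if "t \<ge> 0" for x t
    using sublinear_add[OF p, of "x + t *\<^sub>R y" "- x"] scale[OF that] by (simp add: h_def)
  then have bdd: "bdd_below (h x ` {0..})" for x
    by (intro bdd_belowI2[of _ "- p (- x)"]) auto
  have q_le: "q x \<le> h x t" if "t \<ge> 0" for x t
    unfolding q_def using that by (intro cINF_lower[OF bdd]) auto
  have "sublinear q"
  proof (rule sublinearI)
    fix x x'
    have "q (x + x') \<le> h x t + h x' s" if "t \<ge> 0" "s \<ge> 0" for t s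
    proof -
      have "q (x + x') \<le> h (x + x') (t + s)"
        using that by (intro q_le) simp
      also have "\<dots> \<le> h x t + h x' s"
        using sublinear_add[OF p, of "x + t *\<^sub>R y" "x' + s *\<^sub>R y"]
        by (simp add: h_def algebra_simps)
      finally show ?thesis .
    qed
    then have "q (x + x') - h x' s \<le> q x" if "s \<ge> 0" for s
      unfolding q_def[of x] using that by (intro cINF_greatest) (auto simp: algebra_simps)
    then have "q (x + x') - q x \<le> q x'"
      unfolding q_def[of x'] by (intro cINF_greatest) (auto simp: algebra_simps)
    then show "q (x + x') \<le> q x + q x'"
      by simp
  next
    fix t :: real and x assume t: "t > 0"
    \<comment> \<open>Scaling \<open>x\<close> by \<open>t\<close> rescales the parameter by
      \<open>t\<close>, which maps the half-line onto itself, so both infima range over the same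
      values.\<close>
    have "h (t *\<^sub>R x) (t * s) = t * h x s" for s
      using sublinear_scaleR[OF p t, of "x + s *\<^sub>R y"] by (simp add: h_def algebra_simps)
    then have "t * q x = (INF s\<in>{0..}. h (t *\<^sub>R x) (t * s))"
      using INF_positive_homogeneous[OF _ bdd t] by (simp add: q_def)
    also have "\<dots> = (INF s\<in>(*) t ` {0..}. h (t *\<^sub>R x) s)"
      by (simp add: image_image)
    also have "(*) t ` {0..} = {0..}"
      using t by (auto simp: image_iff intro!: bexI[of _ "_ / t"])
    finally show "q (t *\<^sub>R x) = t * q x"
      by (simp add: q_def)
  qed
  moreover have "q x \<le> p x" for x
    using q_le[of 0 x] by (simp add: h_def)
  moreover have "q (- y) \<le> - p y"
    using q_le[of 1 "- y"] sublinear_zero[OF p] by (simp add: h_def)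
  ultimately show ?thesis
    using that by blast
qed

text \<open>A minimal sublinear functional is odd, by the reduction above, hence linear.\<close>
theorem linear_below_sublinear:
  fixes p0 :: "'a::real_vector \<Rightarrow> real"
  assumes p0: "sublinear p0"
  obtains g where "linear g" "\<And>x. g x \<le> p0 x"
proof -
  define A where "A = {p. sublinear p \<and> p \<le> p0}"
  \<comment> \<open>The order is reversed, so that the maximal element given by Zorn's lemma is
    pointwise minimal.\<close>
  have "\<exists>m\<in>A. \<forall>a\<in>A. m \<ge> a \<longrightarrow> a = m"
  proof (rule predicate_Zorn)
    show "partial_order_on A (relation_of (\<lambda>p q. p \<ge> q) A)"
      by (rule partial_order_on_relation_ofI) auto
    fix C assume C: "C \<in> Chains (relation_of (\<lambda>p q. p \<ge> q) A)"
    then have chain: "p \<le> q \<or> q \<le> p" if "p \<in> C" "q \<in> C" for p q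
      using that by (auto simp: Chains_def relation_of_def)
    show "\<exists>u\<in>A. \<forall>a\<in>C. a \<ge> u"
    proof (cases "C = {}")
      case True
      then show ?thesis using p0 by (auto simp: A_def)
    next
      case False
      have C_A: "C \<subseteq> A"
        by (rule Chains_relation_of[OF C])
      define u where "u x = (INF p\<in>C. p x)" for x
      have sub: "sublinear p" "p x \<le> p0 x" if "p \<in> C" for p x
        using C_A that by (auto simp: A_def le_fun_def)
      have inf: "bdd_below ((\<lambda>p. p x) ` C)" for x
        by (rule sublinear_INF_chain(1)[of C p0]) (use False sub chain in \<open>blast+\<close>)
      have "u \<le> a" if "a \<in> C" for a
        unfolding le_fun_def u_def using cINF_lower[OF inf that] by blast
      moreover have "u \<le> p0"
        using False calculation sub(2) by (meson ex_in_conv le_fun_def order_trans)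
      moreover have "sublinear u"
        unfolding u_def
        by (rule sublinear_INF_chain(2)[of C p0]) (use False sub chain in \<open>blast+\<close>)
      ultimately show ?thesis by (auto simp: A_def)
    qed
  qed
  then obtain m where m: "sublinear m" "m \<le> p0"
    and min: "\<And>a. sublinear a \<Longrightarrow> a \<le> m \<Longrightarrow> a = m"
    unfolding A_def by (blast intro: order_trans)
  have odd: "m (- y) = - m y" for y
  proof -
    obtain q where q: "sublinear q" "\<And>x. q x \<le> m x" "q (- y) \<le> - m y"
      using sublinear_reduce[OF m(1)] by blast
    then have "q = m" using min by (simp add: le_fun_def)
    with q(3) sublinear_minus[OF m(1), of y] show ?thesis by simp
  qed
  have "linear m"
  proof (rule linearI)
    fix x y
    \<comment> \<open>Subadditivity at the negatives, turned around by oddness, is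
      superadditivity.\<close>
    have "m (- x + - y) \<le> m (- x) + m (- y)"
      by (rule sublinear_add[OF m(1)])
    then have "m x + m y \<le> m (x + y)"
      using odd[of "x + y"] odd[of x] odd[of y] by simp
    with sublinear_add[OF m(1), of x y] show "m (x + y) = m x + m y"
      by simp
  next
    fix r :: real and x
    consider "r > 0" | "r = 0" | "r < 0"
      by (rule linorder_cases[of r 0]) auto
    then show "m (r *\<^sub>R x) = r *\<^sub>R m x"
    proof cases
      case 3
      then have "m ((- r) *\<^sub>R (- x)) = (- r) * m (- x)"
        by (intro sublinear_scaleR[OF m(1)]) simp
      then show ?thesis by (simp add: odd)
    qed (auto simp: sublinear_scaleR[OF m(1)] sublinear_zero[OF m(1)])
  qed
  then show ?thesis
    using that m(2) by (auto simp: le_fun_def)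
qed

text \<open>Hahn-Banach: the norm is first reduced at \<open>y\<close> to some \<open>q\<close>. A
  linear \<open>g\<close> below \<open>q\<close> satisfies \<open>g (- y) \<le> - norm y\<close>,
  hence attains the norm at \<open>y\<close>, and the bound at \<open>x\<close> and
  \<open>- x\<close> controls the absolute value.\<close>

corollary norming_functional:
  fixes y :: "'a::real_normed_vector"
  obtains g :: "'a \<Rightarrow> real"
  where "bounded_linear g" "\<And>x. \<bar>g x\<bar> \<le> norm x" "g y = norm y"
proof -
  have "sublinear (norm :: 'a \<Rightarrow> real)"
    by (rule sublinearI) (auto intro: norm_triangle_ineq)
  then obtain q where q: "sublinear q" "\<And>x. q x \<le> norm x" "q (- y) \<le> - norm y"
    using sublinear_reduce by blast
  obtain g where g: "linear g" "\<And>x. g x \<le> q x"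
    using linear_below_sublinear[OF q(1)] by blast
  have le: "g x \<le> norm x" for x
    using g(2) q(2) order_trans by blast
  have neg: "g (- x) = - g x" for x
    by (rule linear_neg[OF g(1)])
  have abs: "\<bar>g x\<bar> \<le> norm x" for x
    using le[of x] le[of "- x"] neg[of x] by simp
  have "bounded_linear g"
    using g(1) abs by (intro bounded_linear_intro[of _ 1]) (auto simp: linear_add linear_scale)
  moreover have "g y = norm y"
    using neg[of y] g(2)[of "- y"] q(3) le[of y] by simp
  ultimately show ?thesis using that abs by blast
qed

subsection \<open>Random combinations of functionals\<close>

lemma emeasure_uniform_affine_near_zero:
  fixes d r \<epsilon> :: real
  assumes "d > 0" "\<epsilon> > 0" and A: "A \<in> sets borel"
    and sub: "\<And>s. s \<in> A \<Longrightarrow> 0 \<le> s \<Longrightarrow> s \<le> 1 \<Longrightarrow> \<bar>r + s * d\<bar> < \<epsilon>"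
  shows "emeasure (uniform_measure lborel {0..1}) A \<le> ennreal (2 * \<epsilon> / d)"
proof -
  have "{0..1} \<inter> A \<subseteq> {(- \<epsilon> - r) / d .. (\<epsilon> - r) / d}"
    using sub \<open>d > 0\<close> by (fastforce simp: field_simps)
  then have "emeasure lborel ({0..1} \<inter> A) \<le> emeasure lborel {(- \<epsilon> - r) / d .. (\<epsilon> - r) / d}"
    by (intro emeasure_mono) auto
  also have "\<dots> = ennreal (2 * \<epsilon> / d)"
    using assms(1,2) by (subst emeasure_lborel_Icc) (auto simp: field_simps)
  finally show ?thesis
    using A by (subst emeasure_uniform_measure) (auto simp: divide_ennreal_def)
qed

text \<open>Union bound for independent uniform \<open>t\<close>: conditionally on the other coordinates, the
  \<open>n\<close>-th sum is affine in \<open>t n\<close> with slope \<open>b n n\<close>.\<close>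
lemma exists_coefficients_away_from_zero:
  fixes b :: "nat \<Rightarrow> nat \<Rightarrow> real"
  assumes summable: "\<And>n. summable (\<lambda>j. \<bar>b n j\<bar>)"
    and pos: "\<And>n. b n n > 0"
    and inv: "summable (\<lambda>n. 1 / b n n)"
  obtains t \<epsilon> where "\<epsilon> > 0" "\<And>j. 0 \<le> t j \<and> t j \<le> (1::real)"
    "\<And>n. \<epsilon> \<le> \<bar>\<Sum>j. t j * b n j\<bar>"
proof -
  \<comment> \<open>The product space contains all real sequences. Clamping the coordinates makes
    the series converge at every point, not just almost surely, and changes nothing on
    \<open>[0, 1]\<close>, where the uniform measure lives.\<close>
  define cl :: "real \<Rightarrow> real" where "cl s = max 0 (min 1 s)" for s
  have cl: "0 \<le> cl s" "cl s \<le> 1" for s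
    by (auto simp: cl_def)
  define M where "M = uniform_measure lborel {0..1::real}"
  interpret M: prob_space M
    unfolding M_def by (rule prob_space_uniform_measure) auto
  define P where "P = PiM (UNIV :: nat set) (\<lambda>_. M)"
  interpret P: prob_space P
    unfolding P_def by (rule prob_space_PiM) (rule M.prob_space_axioms)
  interpret MP: pair_sigma_finite M P ..
  have sets_M [measurable_cong]: "sets M = sets borel"
    by (simp add: M_def)
  have [measurable]: "cl \<in> borel_measurable borel"
    unfolding cl_def by measurable
  define F where "F n t = (\<Sum>j. cl (t j) * b n j)" for n and t :: "nat \<Rightarrow> real"
  have [measurable]: "F n \<in> borel_measurable P" for n
    unfolding F_def P_def by measurable
  have summ: "summable (\<lambda>j. cl (t j) * b n j)" for n t
    using cl by (intro summable_comparison_test'[OF summable[of n]])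
      (auto simp: abs_mult intro: mult_left_le_one_le)
  have F_upd: "F n (t(n := s)) = F n (t(n := 0)) + cl s * b n n" for n t s
  proof -
    have "F n (t(n := s)) - F n (t(n := 0)) =
        (\<Sum>j. cl ((t(n := s)) j) * b n j - cl ((t(n := 0)) j) * b n j)"
      unfolding F_def by (rule suminf_diff[OF summ summ])
    also have "\<dots> = (\<Sum>j. if j = n then cl s * b n n else 0)"
      by (intro suminf_cong) (auto simp: cl_def)
    also have "\<dots> = cl s * b n n"
      by (intro sums_unique[symmetric] sums_single)
    finally show ?thesis by simp
  qed
  define c where "c = (\<Sum>n. 1 / b n n)"
  have "c \<ge> 0"
    unfolding c_def using inv pos by (intro suminf_nonneg) (auto intro: less_imp_le)
  \<comment> \<open>Chosen so that the union bound, whose total is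
    \<open>2 * \<epsilon> * c\<close>, stays below \<open>1\<close>.\<close>
  define \<epsilon> where "\<epsilon> = 1 / (4 * (c + 1))"
  have \<epsilon>: "\<epsilon> > 0" "2 * \<epsilon> * c < 1"
    using \<open>c \<ge> 0\<close> by (auto simp: \<epsilon>_def field_simps)
  define E where "E n = {t \<in> space P. \<bar>F n t\<bar> < \<epsilon>}" for n
  have E [measurable]: "E n \<in> sets P" for n
    unfolding E_def by measurable
  have bad: "emeasure P (E n) \<le> ennreal (2 * \<epsilon> / b n n)" for n
  proof -
    \<comment> \<open>Resampling coordinate \<open>n\<close> preserves \<open>P\<close>. The
      probability of \<open>E n\<close> is therefore an average over \<open>t\<close> of
      probabilities in the single variable \<open>s\<close>, each controlled by the slope
      \<open>b n n\<close>.\<close>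
    let ?u = "\<lambda>(s, t). t(n := s) :: nat \<Rightarrow> real"
    have u: "?u \<in> measurable (M \<Otimes>\<^sub>M P) P"
      unfolding P_def split_beta'
    proof (rule measurable_PiM_single')
      fix i
      show "(\<lambda>x. ((snd x)(n := fst x)) i) \<in> measurable (M \<Otimes>\<^sub>M PiM UNIV (\<lambda>_. M)) M"
        by (cases "i = n") simp_all
    qed (auto simp: space_PiM space_pair_measure M_def)
    have "P = distr (M \<Otimes>\<^sub>M P) P ?u"
      using distr_pair_PiM_eq_PiM[of UNIV "\<lambda>_. M" n] M.prob_space_axioms
      by (simp add: P_def)
    then have "emeasure P (E n) = emeasure (distr (M \<Otimes>\<^sub>M P) P ?u) (E n)"
      by simp
    also have "\<dots> = emeasure (M \<Otimes>\<^sub>M P) (?u -` E n \<inter> space (M \<Otimes>\<^sub>M P))"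
      by (rule emeasure_distr[OF u E])
    also have "\<dots> = (\<integral>\<^sup>+ t. emeasure M ((\<lambda>s. (s, t)) -` (?u -` E n \<inter> space (M \<Otimes>\<^sub>M P))) \<partial>P)"
      by (rule MP.emeasure_pair_measure_alt2[OF measurable_sets[OF u E]])
    also have "\<dots> \<le> (\<integral>\<^sup>+ t. ennreal (2 * \<epsilon> / b n n) \<partial>P)"
    proof (rule nn_integral_mono)
      fix t
      have "(\<lambda>s. (s, t)) -` (?u -` E n \<inter> space (M \<Otimes>\<^sub>M P)) \<in> sets M"
        by (rule sets_Pair2[OF measurable_sets[OF u E]])
      then have "(\<lambda>s. (s, t)) -` (?u -` E n \<inter> space (M \<Otimes>\<^sub>M P)) \<in> sets borel"
        by (simp add: M_def)
      moreover have "\<bar>F n (t(n := 0)) + s * b n n\<bar> < \<epsilon>"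
        if "s \<in> (\<lambda>s. (s, t)) -` (?u -` E n \<inter> space (M \<Otimes>\<^sub>M P))" "0 \<le> s" "s \<le> 1" for s
      proof -
        have "\<bar>F n (t(n := s))\<bar> < \<epsilon>" "cl s = s"
          using that by (auto simp: E_def cl_def)
        then show ?thesis
          using F_upd[of n t s] by simp
      qed
      ultimately show "emeasure M ((\<lambda>s. (s, t)) -` (?u -` E n \<inter> space (M \<Otimes>\<^sub>M P)))
          \<le> ennreal (2 * \<epsilon> / b n n)"
        unfolding M_def by (rule emeasure_uniform_affine_near_zero[OF pos \<epsilon>(1)])
    qed
    also have "\<dots> = ennreal (2 * \<epsilon> / b n n)"
      by (simp add: P.emeasure_space_1)
    finally show ?thesis .
  qed
  have "emeasure P (\<Union>n. E n) \<le> (\<Sum>n. emeasure P (E n))"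
    by (rule emeasure_subadditive_countably) auto
  also have "\<dots> \<le> (\<Sum>n. ennreal (2 * \<epsilon> * (1 / b n n)))"
    using bad by (intro suminf_le) auto
  also have "\<dots> = ennreal (2 * \<epsilon> * c)"
    using pos \<epsilon> inv
    by (subst suminf_ennreal2)
      (auto simp: c_def suminf_mult summable_mult less_imp_le simp del: times_divide_eq_right)
  also have "\<dots> < 1"
    using \<epsilon>(2) by (simp add: ennreal_less_one_iff)
  finally have "(\<Union>n. E n) \<noteq> space P"
    using P.emeasure_space_1 by auto
  moreover have "(\<Union>n. E n) \<subseteq> space P"
    by (auto simp: E_def)
  ultimately obtain t where "t \<in> space P" "\<And>n. t \<notin> E n"
    by blast
  then have "\<epsilon> \<le> \<bar>\<Sum>j. cl (t j) * b n j\<bar>" for n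
    by (auto simp: E_def F_def not_less)
  then show ?thesis
    using that[OF \<epsilon>(1), of "\<lambda>j. cl (t j)"] cl by blast
qed

text \<open>Each norming functional of \<open>x j\<close> gets the weight
  \<open>1 / sqrt (norm (x j))\<close>. These weights are summable, so the random series converges
  to a bounded functional, while the diagonal coefficients are still
  \<open>sqrt (norm (x n))\<close>, whose reciprocals form the same summable series.\<close>

lemma functional_away_from_zero:
  fixes x :: "nat \<Rightarrow> 'a::real_normed_vector"
  assumes nz: "\<And>n. x n \<noteq> 0" and inv: "summable (\<lambda>n. 1 / sqrt (norm (x n)))"
  obtains g :: "'a \<Rightarrow> real" and \<epsilon>
  where "bounded_linear g" "\<epsilon> > 0" "\<And>n. \<epsilon> \<le> \<bar>g (x n)\<bar>"
proof -
  have "\<exists>g. bounded_linear g \<and> (\<forall>y. \<bar>g y\<bar> \<le> norm y) \<and> g (x j) = norm (x j)" for j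
    by (rule norming_functional[of "x j"]) blast
  then obtain f where f: "\<And>j. bounded_linear (f j)" "\<And>j y. \<bar>f j y\<bar> \<le> norm y"
      "\<And>j. f j (x j) = norm (x j)"
    by metis
  define w where "w j = 1 / sqrt (norm (x j))" for j
  have w: "w j \<ge> 0" "summable w" for j
    using inv by (simp_all add: w_def[abs_def])
  define b where "b n j = w j * f j (x n)" for n j
  have diag: "b n n = sqrt (norm (x n))" for n
    using nz[of n] by (simp add: b_def w_def f real_div_sqrt)
  have summ_f: "summable (\<lambda>j. \<bar>w j * f j y\<bar>)" for y
    using f(2) w by (intro summable_comparison_test'[OF summable_mult2[OF w(2), of "norm y"]])
      (auto simp: abs_mult intro!: mult_left_mono)
  obtain t \<epsilon> where t: "\<epsilon> > 0" "\<And>j. 0 \<le> t j \<and> t j \<le> (1::real)"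
    "\<And>n. \<epsilon> \<le> \<bar>\<Sum>j. t j * b n j\<bar>"
  proof (rule exists_coefficients_away_from_zero[of b])
    show "summable (\<lambda>j. \<bar>b n j\<bar>)" for n
      unfolding b_def by (rule summ_f)
    show "b n n > 0" for n
      using nz by (simp add: diag)
    show "summable (\<lambda>n. 1 / b n n)"
      unfolding diag by (rule inv)
  qed (rule that)
  define g where "g y = (\<Sum>j. t j * (w j * f j y))" for y
  have le: "\<bar>t j * (w j * f j y)\<bar> \<le> w j * norm y" for j y
  proof -
    have "\<bar>t j * (w j * f j y)\<bar> \<le> 1 * \<bar>w j * f j y\<bar>"
      unfolding abs_mult[of "t j"] using t(2)[of j] by (intro mult_right_mono) auto
    also have "\<dots> \<le> w j * norm y"
      using f(2) w by (auto simp: abs_mult intro!: mult_left_mono)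
    finally show ?thesis .
  qed
  have summ: "summable (\<lambda>j. t j * (w j * f j y))" for y
    using le by (intro summable_comparison_test'[OF summable_mult2[OF w(2), of "norm y"]]) auto
  have "bounded_linear g"
  proof (rule bounded_linear_intro)
    fix y z
    show "g (y + z) = g y + g z"
      unfolding g_def suminf_add[OF summ summ]
      by (intro suminf_cong) (simp add: linear_add[OF bounded_linear.linear[OF f(1)]] algebra_simps)
  next
    fix r y
    show "g (r *\<^sub>R y) = r *\<^sub>R g y"
      unfolding g_def real_scaleR_def suminf_mult[OF summ, symmetric]
      by (intro suminf_cong) (simp add: linear_scale[OF bounded_linear.linear[OF f(1)]])
  next
    fix y
    have "norm (g y) \<le> (\<Sum>j. w j * norm y)"
      unfolding g_def using le by (intro norm_suminf_le summable_mult2 w) auto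
    then show "norm (g y) \<le> norm y * (\<Sum>j. w j)"
      using suminf_mult2[OF w(2), of "norm y"] by (simp add: mult.commute)
  qed
  moreover have "\<epsilon> \<le> \<bar>g (x n)\<bar>" for n
    using t(3)[of n] by (simp add: g_def b_def)
  ultimately show ?thesis
    using that t(1) by blast
qed

subsection \<open>Binomial weights and the growth of orbits\<close>

text \<open>The ratio of \<open>n choose k\<close> to \<open>Suc n choose k\<close> is
  \<open>(Suc n - k) / Suc n\<close>. Together with its companion for \<open>Suc k\<close>, this
  moves two expansions of degree \<open>n\<close> onto the common weights of degree
  \<open>Suc n\<close>, where they can be compared term by term.\<close>

lemma Bernstein_Suc_left:
  assumes "k \<le> n" "x \<noteq> 1"
  shows "Bernstein n k x =
    Bernstein (Suc n) k x * ((real (Suc n) - real k) / (real (Suc n) * (1 - x)))"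
proof -
  have "(Suc n - k) * (Suc n choose k) = Suc n * (n choose k)"
    using binomial_absorb_comp[of "Suc n" k] by simp
  then have "real ((Suc n - k) * (Suc n choose k)) = real (Suc n * (n choose k))"
    by presburger
  then have *: "(real (Suc n) - real k) * real (Suc n choose k) = real (Suc n) * real (n choose k)"
    using assms(1) by (simp only: of_nat_mult of_nat_diff le_SucI)
  have "Bernstein (Suc n) k x * (real (Suc n) - real k) =
      ((real (Suc n) - real k) * real (Suc n choose k)) * x ^ k * ((1 - x) ^ (n - k) * (1 - x))"
    using assms(1) by (simp add: Bernstein_def Suc_diff_le del: of_nat_Suc)
  also have "\<dots> = Bernstein n k x * (real (Suc n) * (1 - x))"
    unfolding * by (simp add: Bernstein_def)
  finally have "Bernstein (Suc n) k x * (real (Suc n) - real k) =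
      Bernstein n k x * (real (Suc n) * (1 - x))" .
  moreover have "real (Suc n) * (1 - x) \<noteq> 0"
    using assms(2) by simp
  ultimately show ?thesis
    by (metis nonzero_mult_div_cancel_right times_divide_eq_right)
qed

lemma Bernstein_Suc_right:
  assumes "x \<noteq> 0"
  shows "Bernstein n k x = Bernstein (Suc n) (Suc k) x * (real (Suc k) / (real (Suc n) * x))"
proof -
  have "real (Suc k * (Suc n choose Suc k)) = real (Suc n * (n choose k))"
    by (simp only: Suc_times_binomial)
  then have *: "real (Suc k) * real (Suc n choose Suc k) = real (Suc n) * real (n choose k)"
    by (simp only: of_nat_mult)
  have "Bernstein (Suc n) (Suc k) x * real (Suc k) =
      (real (Suc k) * real (Suc n choose Suc k)) * (x ^ k * x) * (1 - x) ^ (n - k)"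
    by (simp add: Bernstein_def del: of_nat_Suc binomial_Suc_Suc)
  also have "\<dots> = Bernstein n k x * (real (Suc n) * x)"
    unfolding * by (simp add: Bernstein_def)
  finally have "Bernstein (Suc n) (Suc k) x * real (Suc k) = Bernstein n k x * (real (Suc n) * x)" .
  moreover have "real (Suc n) * x \<noteq> 0"
    using assms by simp
  ultimately show ?thesis
    by (metis nonzero_mult_div_cancel_right times_divide_eq_right)
qed

text \<open>The range may be extended to \<open>Suc n\<close> because the factor
  \<open>real (Suc n) - real k\<close> vanishes there.\<close>

lemma sum_Bernstein_Suc_left:
  fixes v :: "nat \<Rightarrow> 'a::real_vector"
  assumes "x \<noteq> 1"
  shows "(\<Sum>k\<le>n. Bernstein n k x *\<^sub>R v k) = (\<Sum>k\<le>Suc n.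
    (Bernstein (Suc n) k x * ((real (Suc n) - real k) / (real (Suc n) * (1 - x)))) *\<^sub>R v k)"
  using assms Bernstein_Suc_left[of _ n x] by (auto intro!: sum.cong)

text \<open>After the index shift the sum may start at \<open>0\<close>, where the factor
  \<open>real k\<close> vanishes.\<close>

lemma sum_Bernstein_Suc_right:
  fixes v :: "nat \<Rightarrow> 'a::real_vector"
  assumes "x \<noteq> 0"
  shows "(\<Sum>k\<le>n. Bernstein n k x *\<^sub>R v (Suc k)) = (\<Sum>k\<le>Suc n.
    (Bernstein (Suc n) k x * (real k / (real (Suc n) * x))) *\<^sub>R v k)"
  unfolding sum.atMost_Suc_shift using Bernstein_Suc_right[OF assms, of n]
  by (auto intro!: sum.cong)

lemma Bernstein_variance:
  "(\<Sum>k\<le>n. Bernstein n k x * (real n * x - real k)\<^sup>2) = real n * x * (1 - x)"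
proof -
  \<comment> \<open>The square is rewritten in terms of \<open>1\<close>, \<open>k\<close> and
    \<open>k (k - 1)\<close>, whose Bernstein sums are known.\<close>
  have "(\<Sum>k\<le>n. Bernstein n k x * (real n * x - real k)\<^sup>2) =
     (\<Sum>k\<le>n. (real n * x)\<^sup>2 * Bernstein n k x + (1 - 2 * (real n * x)) * (real k * Bernstein n k x)
        + real k * (real k - 1) * Bernstein n k x)"
    by (intro sum.cong) (auto simp: algebra_simps power2_eq_square)
  also have "\<dots> = (real n * x)\<^sup>2 + (1 - 2 * (real n * x)) * (real n * x) + real n * (real n - 1) * x\<^sup>2"
    by (simp add: sum.distrib flip: sum_distrib_left)
  finally show ?thesis
    by (simp add: algebra_simps power2_eq_square)
qed

lemma Bernstein_mean_deviation:
  assumes "0 < x" "x < 1"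
  shows "(\<Sum>k\<le>n. Bernstein n k x * \<bar>real n * x - real k\<bar>) \<le> sqrt (real n * x * (1 - x))"
proof (cases "n = 0")
  case False
  define s where "s = sqrt (real n * x * (1 - x))"
  have s: "s > 0" "s * s = real n * x * (1 - x)"
    using assms False by (auto simp: s_def)
  \<comment> \<open>This inequality replaces Cauchy-Schwarz. As \<open>s\<close> is the standard
    deviation, each of the two terms contributes \<open>s / 2\<close> after summation.\<close>
  have "\<bar>a\<bar> \<le> (a\<^sup>2 / s + s) / 2" for a
    using s(1) zero_le_power2[of "\<bar>a\<bar> - s"] by (simp add: power2_eq_square field_simps)
  then have "(\<Sum>k\<le>n. Bernstein n k x * \<bar>real n * x - real k\<bar>)
      \<le> (\<Sum>k\<le>n. Bernstein n k x * (((real n * x - real k)\<^sup>2 / s + s) / 2))"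
    using assms by (intro sum_mono mult_left_mono Bernstein_nonneg) auto
  also have "\<dots> = (\<Sum>k\<le>n. (1 / (2 * s)) * (Bernstein n k x * (real n * x - real k)\<^sup>2)
      + (s / 2) * Bernstein n k x)"
    by (intro sum.cong) (auto simp: algebra_simps add_divide_distrib)
  also have "\<dots> = (1 / (2 * s)) * (s * s) + s / 2"
    unfolding s(2) sum.distrib sum_distrib_left[symmetric] Bernstein_variance by simp
  also have "\<dots> = s"
    using s(1) by simp
  finally show ?thesis unfolding s_def .
qed (simp add: Bernstein_def)

section \<open>Orbit growth when \<open>R\<close> contracts a seminorm\<close>

locale seminorm_contraction =
  fixes \<nu> :: "'a::real_vector \<Rightarrow> real" and R T :: "'a \<Rightarrow> 'a" and c :: real
  assumes R_linear: "linear R"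
    and \<nu>_add: "\<nu> (x + y) \<le> \<nu> x + \<nu> y"
    and \<nu>_scaleR: "\<nu> (r *\<^sub>R x) = \<bar>r\<bar> * \<nu> x"
    and \<nu>_R: "\<nu> (R x) \<le> \<nu> x"
    and c_pos: "c > 0"
    and T_eq: "T x = (1 + c) *\<^sub>R x - c *\<^sub>R R x"
begin

lemma T_linear: "linear T"
proof -
  have "linear (\<lambda>x. (1 + c) *\<^sub>R x - c *\<^sub>R R x)"
    by (intro linear_compose_sub linear_compose_scale_right R_linear linear_ident)
  moreover have "T = (\<lambda>x. (1 + c) *\<^sub>R x - c *\<^sub>R R x)"
    by (rule ext) (rule T_eq)
  ultimately show ?thesis by simp
qed

lemma TR_commute: "T (R x) = R (T x)"
  by (simp add: T_eq linear_diff[OF R_linear] linear_scale[OF R_linear])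

lemma T_funpow_R: "(T ^^ n) (R x) = R ((T ^^ n) x)"
  by (induction n) (simp_all add: TR_commute)

lemma T_funpow_diff: "(T ^^ n) (T x - R x) = T ((T ^^ n) x) - R ((T ^^ n) x)"
proof -
  have "(T ^^ n) (y - z) = (T ^^ n) y - (T ^^ n) z" for y z
    by (induction n) (simp_all add: linear_diff[OF T_linear])
  then show ?thesis
    by (simp add: T_funpow_R funpow_swap1)
qed

lemma \<nu>_nonneg: "\<nu> x \<ge> 0"
  using \<nu>_add[of x "- x"] \<nu>_scaleR[of "- 1" x] \<nu>_scaleR[of 0 x] by simp

lemma \<nu>_sum: "finite A \<Longrightarrow> \<nu> (\<Sum>i\<in>A. f i) \<le> (\<Sum>i\<in>A. \<nu> (f i))"
proof (induction A rule: finite_induct)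
  case empty
  show ?case using \<nu>_scaleR[of 0 0] by simp
next
  case (insert a A)
  then show ?case using \<nu>_add[of "f a" "sum f A"] by simp
qed

text \<open>In \<open>(1 + c) x = T x + c R x\<close> the last term has size at most
  \<open>c * \<nu> x\<close>.\<close>

lemma \<nu>_T: "\<nu> x \<le> \<nu> (T x)"
proof -
  have "(1 + c) *\<^sub>R x = T x + c *\<^sub>R R x"
    by (simp add: T_eq)
  then have "(1 + c) * \<nu> x \<le> \<nu> (T x) + c * \<nu> (R x)"
    using \<nu>_add[of "T x" "c *\<^sub>R R x"] \<nu>_scaleR[of "1 + c" x] \<nu>_scaleR[of c "R x"] c_pos by simp
  also have "\<dots> \<le> \<nu> (T x) + c * \<nu> x"
    using \<nu>_R c_pos by simp
  finally show ?thesis by (simp add: algebra_simps)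
qed

lemma \<nu>_T_funpow_mono: "m \<le> n \<Longrightarrow> \<nu> ((T ^^ m) x) \<le> \<nu> ((T ^^ n) x)"
  by (induction n rule: dec_induct) (auto intro: order_trans[OF _ \<nu>_T])

lemma \<nu>_R_funpow: "\<nu> ((R ^^ n) x) \<le> \<nu> x"
  by (induction n) (auto intro: order_trans[OF \<nu>_R])

definition q :: real where "q = c / (1 + c)"

lemma q_bounds: "0 < q" "q < 1" "q \<noteq> 0" "q \<noteq> 1"
  using c_pos by (auto simp: q_def field_simps)

text \<open>The binomial expansion of \<open>((1 - q) T + q R) ^ n\<close>, where \<open>(1 - q) T + q R\<close> is the identity.\<close>
lemma Bernstein_expansion:
  "(\<Sum>k\<le>n. Bernstein n k q *\<^sub>R (R ^^ k) ((T ^^ (n - k)) x)) = x"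
proof (induction n arbitrary: x)
  case 0
  show ?case by (simp add: Bernstein_def)
next
  case (Suc n)
  define v where "v k = (R ^^ k) ((T ^^ (Suc n - k)) x)" for k
  have id: "(1 - q) *\<^sub>R T x + q *\<^sub>R R x = x"
  proof -
    have "(1 - q) * (1 + c) = 1" "(1 - q) * c = q"
      using c_pos by (auto simp: q_def field_simps)
    then show ?thesis
      by (simp only: T_eq scaleR_diff_right scaleR_scaleR) simp
  qed
  \<comment> \<open>Pascal's rule for weights: the share \<open>(Suc n - k) / Suc n\<close> of each
    weight goes to the expansion of \<open>T x\<close>, the share \<open>k / Suc n\<close> to that
    of \<open>R x\<close>.\<close>
  have "(\<Sum>k\<le>Suc n. Bernstein (Suc n) k q *\<^sub>R v k) =
      (\<Sum>k\<le>Suc n. (1 - q) *\<^sub>R (Bernstein (Suc n) k q *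
          ((real (Suc n) - real k) / (real (Suc n) * (1 - q)))) *\<^sub>R v k
        + q *\<^sub>R (Bernstein (Suc n) k q * (real k / (real (Suc n) * q))) *\<^sub>R v k)"
  proof (intro sum.cong refl)
    fix k
    have "N \<noteq> 0 \<Longrightarrow> (1 - q) * (B * ((N - a) / (N * (1 - q)))) + q * (B * (a / (N * q))) = B"
      for N a B :: real
      using q_bounds by (simp add: divide_simps) (simp add: algebra_simps)
    from this[of "real (Suc n)" "Bernstein (Suc n) k q" "real k"]
    show "Bernstein (Suc n) k q *\<^sub>R v k =
        (1 - q) *\<^sub>R (Bernstein (Suc n) k q *
          ((real (Suc n) - real k) / (real (Suc n) * (1 - q)))) *\<^sub>R v k
        + q *\<^sub>R (Bernstein (Suc n) k q * (real k / (real (Suc n) * q))) *\<^sub>R v k"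
      unfolding scaleR_scaleR scaleR_add_left[symmetric] by simp
  qed
  also have "\<dots> = (1 - q) *\<^sub>R (\<Sum>k\<le>n. Bernstein n k q *\<^sub>R v k)
      + q *\<^sub>R (\<Sum>k\<le>n. Bernstein n k q *\<^sub>R v (Suc k))"
    unfolding sum_Bernstein_Suc_left[OF q_bounds(4), of n v]
      sum_Bernstein_Suc_right[OF q_bounds(3), of n v]
    by (simp only: sum.distrib scaleR_sum_right)
  also have "(\<Sum>k\<le>n. Bernstein n k q *\<^sub>R v k) = T x"
    using Suc.IH[of "T x"] by (simp add: v_def Suc_diff_le funpow_swap1)
  also have "(\<Sum>k\<le>n. Bernstein n k q *\<^sub>R v (Suc k)) = R x"
    using Suc.IH[of "R x"] by (simp add: v_def T_funpow_R funpow_swap1)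
  finally show ?case
    by (simp only: id v_def)
qed

text \<open>The expansions of \<open>T x\<close> and \<open>R x\<close> of degree
  \<open>n - 1\<close> use the same vectors \<open>R ^ k (T ^ (n - k) x)\<close>, with the index
  shifted by one for \<open>R x\<close>. Their difference has coefficients
  \<open>Bernstein n k q * (n q - k) / s\<close>, where \<open>s = n q (1 - q)\<close> is the
  binomial variance, so the mean deviation bounds the absolute sum by
  \<open>1 / sqrt s\<close>.\<close>

lemma \<nu>_diff_le:
  assumes "n > 0"
  shows "sqrt (real n * q * (1 - q)) * \<nu> (T x - R x) \<le> \<nu> ((T ^^ n) x)"
proof -
  obtain m where n: "n = Suc m"
    using assms gr0_implies_Suc by blast
  define s where "s = real n * q * (1 - q)"
  have s: "s > 0"
    using assms q_bounds by (simp add: s_def)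
  define v where "v k = (R ^^ k) ((T ^^ (n - k)) x)" for k
  have v: "\<nu> (v k) \<le> \<nu> ((T ^^ n) x)" for k
    unfolding v_def by (rule order_trans[OF \<nu>_R_funpow \<nu>_T_funpow_mono]) simp
  have "T x - R x = (\<Sum>k\<le>m. Bernstein m k q *\<^sub>R v k) - (\<Sum>k\<le>m. Bernstein m k q *\<^sub>R v (Suc k))"
    using Bernstein_expansion[where n = m and x = "T x"] Bernstein_expansion[where n = m and x = "R x"]
    by (simp add: v_def n Suc_diff_le T_funpow_R funpow_swap1)
  also have "\<dots> = (\<Sum>k\<le>n. (Bernstein n k q * ((real n * q - real k) / s)) *\<^sub>R v k)"
    unfolding sum_Bernstein_Suc_left[OF q_bounds(4), of m v]
      sum_Bernstein_Suc_right[OF q_bounds(3), of m v]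
      sum_subtractf[symmetric] n[symmetric] scaleR_diff_left[symmetric] right_diff_distrib[symmetric]
  proof (intro sum.cong refl arg_cong2[where f = scaleR] arg_cong2[where f = "(*)"])
    fix k
    have "a \<noteq> 0 \<Longrightarrow> y \<noteq> 0 \<Longrightarrow> 1 - y \<noteq> 0 \<Longrightarrow>
        (a - b) / (a * (1 - y)) - b / (a * y) = (a * y - b) / (a * y * (1 - y))" for a b y :: real
      by (simp add: divide_simps) (simp add: algebra_simps)
    then show "(real n - real k) / (real n * (1 - q)) - real k / (real n * q) = (real n * q - real k) / s"
      unfolding s_def using q_bounds assms by simp
  qed
  finally have "\<nu> (T x - R x) \<le> (\<Sum>k\<le>n. \<bar>Bernstein n k q * ((real n * q - real k) / s)\<bar> * \<nu> (v k))"
    by (simp only: \<nu>_scaleR[symmetric] \<nu>_sum finite_atMost)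
  also have "\<dots> \<le> (\<Sum>k\<le>n. \<bar>Bernstein n k q * ((real n * q - real k) / s)\<bar> * \<nu> ((T ^^ n) x))"
    using v by (intro sum_mono mult_left_mono) auto
  also have "\<dots> = (\<Sum>k\<le>n. Bernstein n k q * \<bar>real n * q - real k\<bar>) * (\<nu> ((T ^^ n) x) / s)"
    using s q_bounds Bernstein_nonneg[of q n]
    by (simp add: sum_distrib_right sum_divide_distrib abs_mult)
  also have "\<dots> \<le> sqrt s * (\<nu> ((T ^^ n) x) / s)"
    unfolding s_def using q_bounds s \<nu>_nonneg
    by (intro mult_right_mono Bernstein_mean_deviation) (auto simp: s_def)
  finally have "sqrt s * \<nu> (T x - R x) \<le> sqrt s * (sqrt s * (\<nu> ((T ^^ n) x) / s))"
    using s by (intro mult_left_mono) auto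
  also have "\<dots> = \<nu> ((T ^^ n) x)"
    using s by (simp flip: mult.assoc)
  finally show ?thesis
    unfolding s_def .
qed

text \<open>\<open>T - R\<close> commutes with \<open>T\<close>, so the previous estimate can be
  iterated: every further \<open>n\<close> applications of \<open>T\<close> pay for one more factor
  \<open>T - R\<close>.\<close>

lemma \<nu>_diff_funpow_le:
  assumes "n > 0"
  shows "sqrt (real n * q * (1 - q)) ^ k * \<nu> (((\<lambda>x. T x - R x) ^^ k) x) \<le> \<nu> ((T ^^ (k * n)) x)"
proof (induction k arbitrary: x)
  case 0
  show ?case by simp
next
  case (Suc k)
  let ?s = "sqrt (real n * q * (1 - q))"
  have "?s ^ Suc k * \<nu> (((\<lambda>x. T x - R x) ^^ Suc k) x)
      = ?s * (?s ^ k * \<nu> (((\<lambda>x. T x - R x) ^^ k) (T x - R x)))"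
    by (simp only: funpow_Suc_right o_apply power_Suc mult.assoc)
  also have "\<dots> \<le> ?s * \<nu> ((T ^^ (k * n)) (T x - R x))"
    using q_bounds by (intro mult_left_mono Suc.IH) simp
  also have "\<dots> \<le> \<nu> ((T ^^ n) ((T ^^ (k * n)) x))"
    unfolding T_funpow_diff by (rule \<nu>_diff_le[OF assms])
  finally show ?case
    by (simp add: funpow_add)
qed

end

section \<open>Renorming a power bounded operator\<close>

locale power_bounded =
  fixes R T :: "'a::real_normed_vector \<Rightarrow> 'a" and c M :: real
  assumes R_linear: "linear R"
    and R_bound: "norm ((R ^^ n) x) \<le> M * norm x"
    and c_pos: "c > 0"
    and T_eq: "T x = (1 + c) *\<^sub>R x - c *\<^sub>R R x"
begin

text \<open>An equivalent norm, between \<open>norm x\<close> and \<open>M * norm x\<close>.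
  Applying \<open>R\<close> drops the first term of the supremum, so \<open>R\<close> becomes a
  contraction.\<close>

definition \<nu> :: "'a \<Rightarrow> real" where "\<nu> x = (SUP n. norm ((R ^^ n) x))"

lemma bdd_above_orbit: "bdd_above (range (\<lambda>n. norm ((R ^^ n) x)))"
  by (intro bdd_aboveI2[of _ _ "M * norm x"] R_bound)

lemma norm_funpow_le: "norm ((R ^^ n) x) \<le> \<nu> x"
  unfolding \<nu>_def by (rule cSUP_upper[OF UNIV_I bdd_above_orbit])

lemma norm_le: "norm x \<le> \<nu> x"
  using norm_funpow_le[of 0 x] by simp

lemma \<nu>_le: "\<nu> x \<le> M * norm x"
  unfolding \<nu>_def by (intro cSUP_least R_bound) simp

lemma R_funpow_linear: "linear (R ^^ n)"
  by (induction n) (simp_all add: linear_compose[OF _ R_linear] linear_id[unfolded id_def] id_def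
      del: comp_apply)

sublocale seminorm_contraction \<nu> R T c
proof (rule seminorm_contraction.intro)
  show "linear R" "c > 0"
    by (fact R_linear c_pos)+
  show "T x = (1 + c) *\<^sub>R x - c *\<^sub>R R x" for x
    by (rule T_eq)
  show "\<nu> (x + y) \<le> \<nu> x + \<nu> y" for x y
    unfolding \<nu>_def[of "x + y"]
  proof (rule cSUP_least)
    fix n
    have "norm ((R ^^ n) (x + y)) \<le> norm ((R ^^ n) x) + norm ((R ^^ n) y)"
      unfolding linear_add[OF R_funpow_linear] by (rule norm_triangle_ineq)
    also have "\<dots> \<le> \<nu> x + \<nu> y"
      by (intro add_mono norm_funpow_le)
    finally show "norm ((R ^^ n) (x + y)) \<le> \<nu> x + \<nu> y" .
  qed simp
  have scale: "\<nu> (r *\<^sub>R x) \<le> \<bar>r\<bar> * \<nu> x" for r x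
    unfolding \<nu>_def[of "r *\<^sub>R x"]
    by (rule cSUP_least) (simp_all add: linear_scale[OF R_funpow_linear] mult_left_mono norm_funpow_le)
  show "\<nu> (r *\<^sub>R x) = \<bar>r\<bar> * \<nu> x" for r x
  proof (cases "r = 0")
    case True
    have "\<nu> (0 :: 'a) = 0"
      using \<nu>_le[of 0] norm_le[of 0] by simp
    with True show ?thesis by simp
  next
    case False
    \<comment> \<open>The reverse inequality is the one already shown, applied to the scalar
      \<open>1 / r\<close>.\<close>
    then have "\<nu> x \<le> \<bar>1 / r\<bar> * \<nu> (r *\<^sub>R x)"
      using scale[of "1 / r" "r *\<^sub>R x"] by simp
    with False scale[of r x] show ?thesis
      by (simp add: field_simps)
  qed
  show "\<nu> (R x) \<le> \<nu> x" for x
    unfolding \<nu>_def[of "R x"]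
  proof (rule cSUP_least)
    show "norm ((R ^^ n) (R x)) \<le> \<nu> x" for n
      using norm_funpow_le[of "Suc n" x] by (simp add: funpow_swap1)
  qed simp
qed

text \<open>If \<open>z = x - R x\<close> is fixed by \<open>R\<close>, then
  \<open>(R ^^ n) x = x - n z\<close>, and a bounded orbit forces \<open>z = 0\<close>. Thus
  \<open>I - R\<close> and its square have the same kernel.\<close>

lemma R_fixed_diff_imp_fixed:
  assumes "R (x - R x) = x - R x"
  shows "R x = x"
proof -
  define z where "z = x - R x"
  have z: "R z = z" "R x = x - z"
    using assms by (simp_all add: z_def)
  have "(R ^^ n) x = x - real n *\<^sub>R z" for n
  proof (induction n)
    case (Suc n)
    have "(R ^^ Suc n) x = R (x - real n *\<^sub>R z)"
      by (simp add: Suc.IH)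
    also have "\<dots> = x - z - real n *\<^sub>R z"
      by (simp add: z linear_diff[OF R_linear] linear_scale[OF R_linear])
    finally show ?case
      by (simp add: algebra_simps)
  qed simp
  then have "real n *\<^sub>R z = x - (R ^^ n) x" for n
    by simp
  then have "real n * norm z \<le> norm x + M * norm x" for n
    using norm_triangle_ineq4[of x "(R ^^ n) x"] R_bound[of n x]
    by (metis add_left_mono norm_scaleR abs_of_nat order_trans)
  then have "norm z = 0"
    by (metis ex_less_of_nat_mult less_le_not_le norm_ge_zero order_le_less)
  then show ?thesis
    by (simp add: z_def)
qed

lemma T_minus_R: "T x - R x = (1 + c) *\<^sub>R (x - R x)"
  by (simp add: T_eq algebra_simps)

text \<open>\<open>T - R\<close> is the multiple \<open>(1 + c) (I - R)\<close>, so the kernel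
  argument for \<open>I - R\<close> lowers the power by one in each induction step.\<close>

lemma diff_funpow_zero_imp_fixed:
  "((\<lambda>x. T x - R x) ^^ Suc k) x = 0 \<Longrightarrow> R x = x"
proof (induction k)
  case 0
  then show ?case
    using c_pos by (simp add: T_minus_R)
next
  case (Suc k)
  define y where "y = ((\<lambda>x. T x - R x) ^^ k) x"
  have "T (T y - R y) - R (T y - R y) = 0"
    using Suc.prems by (simp add: y_def)
  then have "T y - R y = R (T y - R y)"
    using c_pos by (simp only: T_minus_R[of "T y - R y"] scaleR_eq_0_iff) simp
  then have "R (y - R y) = y - R y"
    using c_pos by (simp add: T_minus_R linear_scale[OF R_linear])
  then have "R y = y"
    by (rule R_fixed_diff_imp_fixed)
  then have "T y - R y = 0"
    by (subst T_minus_R) simp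
  then show ?case
    by (intro Suc.IH) (simp add: y_def)
qed

text \<open>Eight factors \<open>T - R\<close>, with \<open>n = m div 8\<close>, yield
  \<open>sqrt n ^ 8 = n ^ 4\<close>. The exponent \<open>4\<close> makes the reciprocal square roots
  of the norms comparable to \<open>1 / (m + 1) ^ 2\<close>, which is summable.\<close>

lemma orbit_growth:
  assumes "T x \<noteq> x"
  obtains \<delta> where "\<delta> > 0" "\<And>m. \<delta> * (real m + 1) ^ 4 \<le> norm ((T ^^ m) x)"
proof -
  define U where "U = (\<lambda>x. T x - R x)"
  define a where "a = \<nu> ((U ^^ 8) x)"
  define s where "s = q * (1 - q)"
  have "(U ^^ Suc 7) x \<noteq> 0"
    using diff_funpow_zero_imp_fixed[of 7 x] assms unfolding U_def
    by (auto simp: T_eq algebra_simps)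
  then have "a > 0"
    using norm_le[of "(U ^^ 8) x"] unfolding a_def
    by (auto intro: less_le_trans[OF _ norm_le])
  have "s > 0"
    using q_bounds by (simp add: s_def)
  have "x \<noteq> 0"
    using assms by (auto simp: linear_0[OF T_linear])
  then have x: "\<nu> x > 0"
    using norm_le[of x] by (smt (verit) zero_less_norm_iff)
  then have "M * norm x > 0"
    using \<nu>_le[of x] by linarith
  then have M: "M > 0"
    by (simp add: zero_less_mult_iff)
  \<comment> \<open>The first entry serves \<open>m < 8\<close>, where \<open>m div 8 = 0\<close>
    and monotonicity along the orbit suffices; the second serves \<open>m \<ge> 8\<close>, where
    \<open>m + 1 \<le> 16 * (m div 8)\<close>.\<close>
  define d where "d = min (\<nu> x / 8 ^ 4) (s ^ 4 * a / 16 ^ 4)"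
  have d: "d > 0"
    using x \<open>a > 0\<close> \<open>s > 0\<close> by (simp add: d_def)
  have "d * (real m + 1) ^ 4 \<le> \<nu> ((T ^^ m) x)" for m
  proof (cases "m < 8")
    case True
    have "d * (real m + 1) ^ 4 \<le> \<nu> x / 8 ^ 4 * 8 ^ 4"
      using True x by (intro mult_mono power_mono) (auto simp: d_def)
    also have "\<dots> \<le> \<nu> ((T ^^ m) x)"
      using \<nu>_T_funpow_mono[of 0 m x] by simp
    finally show ?thesis .
  next
    case False
    define n where "n = m div 8"
    have n: "n > 0" "8 * n \<le> m" "m + 1 \<le> 16 * n"
      using False unfolding n_def by presburger+
    have "real m + 1 \<le> 16 * real n"
      using of_nat_mono[OF n(3), where ?'a = real] by simp
    have "d * (real m + 1) ^ 4 \<le> s ^ 4 * a / 16 ^ 4 * (16 * real n) ^ 4"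
      using \<open>real m + 1 \<le> 16 * real n\<close> \<open>a > 0\<close>
      by (intro mult_mono power_mono) (auto simp: d_def)
    also have "\<dots> = (real n * q * (1 - q)) ^ 4 * a"
      by (simp add: s_def power_mult_distrib)
    also have "(real n * q * (1 - q)) ^ 4 = sqrt (real n * q * (1 - q)) ^ 8"
      using q_bounds power_mult[of "sqrt (real n * q * (1 - q))" 2 4] by simp
    also have "\<dots> * a \<le> \<nu> ((T ^^ (8 * n)) x)"
      unfolding a_def U_def by (rule \<nu>_diff_funpow_le[OF n(1)])
    also have "\<dots> \<le> \<nu> ((T ^^ m) x)"
      by (rule \<nu>_T_funpow_mono[OF n(2)])
    finally show ?thesis .
  qed
  then have "d * (real m + 1) ^ 4 \<le> M * norm ((T ^^ m) x)" for m
    using \<nu>_le order_trans by blast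
  then have "d / M * (real m + 1) ^ 4 \<le> norm ((T ^^ m) x)" for m
    using M by (simp add: field_simps)
  then show ?thesis
    using that[of "d / M"] d M by simp
qed

text \<open>A fixed point has a constant orbit, so any nonzero functional will do; otherwise the
  growth of the orbit feeds the random construction.\<close>

lemma orbit_functional:
  assumes "\<exists>y::'a. y \<noteq> 0"
  obtains g :: "'a \<Rightarrow> real" where "bounded_linear g" "g \<noteq> (\<lambda>_. 0)"
    "T x = x \<or> (\<exists>\<epsilon>>0. \<forall>m. \<epsilon> \<le> \<bar>g ((T ^^ m) x)\<bar>)"
proof (cases "T x = x")
  case True
  obtain y :: 'a where y: "y \<noteq> 0" using assms by blast
  obtain g where g: "bounded_linear g" "\<And>z. \<bar>g z\<bar> \<le> norm z" "g y = norm y"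
    by (rule norming_functional[of y]) blast
  then have "g \<noteq> (\<lambda>_. 0)" using y by auto
  then show ?thesis using that g(1) True by blast
next
  case False
  obtain \<delta> where \<delta>: "\<delta> > 0" "\<And>m. \<delta> * (real m + 1) ^ 4 \<le> norm ((T ^^ m) x)"
    using orbit_growth[OF False] by blast
  have pos: "0 < \<delta> * (real m + 1) ^ 4" for m
    using \<delta>(1) by simp
  have nz: "(T ^^ m) x \<noteq> 0" for m
    using \<delta>(2)[of m] pos[of m] by auto
  have bound: "1 / sqrt (norm ((T ^^ m) x)) \<le> 1 / sqrt \<delta> * (1 / real (Suc m) ^ 2)" for m
  proof -
    have "sqrt \<delta> * real (Suc m) ^ 2 = sqrt (\<delta> * (real m + 1) ^ 4)"
    proof -
      have "(real m + 1) ^ 4 = (real (Suc m) ^ 2) ^ 2"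
        by (simp add: add.commute flip: power_mult)
      then show ?thesis
        by (simp only: real_sqrt_mult real_sqrt_abs) simp
    qed
    also have "\<dots> \<le> sqrt (norm ((T ^^ m) x))"
      using \<delta>(2) by simp
    finally have "1 / sqrt (norm ((T ^^ m) x)) \<le> 1 / (sqrt \<delta> * real (Suc m) ^ 2)"
      using \<delta>(1) by (intro divide_left_mono) (auto simp: nz)
    then show ?thesis by simp
  qed
  have summ: "summable (\<lambda>m. 1 / sqrt \<delta> * (1 / real (Suc m) ^ 2))"
  proof (intro summable_mult)
    show "summable (\<lambda>m. 1 / real (Suc m) ^ 2)"
      using inverse_power_summable[of 2, where ?'a = real]
      by (subst summable_Suc_iff) (simp add: inverse_eq_divide)
  qed
  have "summable (\<lambda>m. 1 / sqrt (norm ((T ^^ m) x)))"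
  proof (rule summable_comparison_test'[OF summ])
    show "norm (1 / sqrt (norm ((T ^^ m) x))) \<le> 1 / sqrt \<delta> * (1 / real (Suc m) ^ 2)" for m
      using bound[of m] by (simp del: of_nat_Suc)
  qed
  from functional_away_from_zero[of "\<lambda>m. (T ^^ m) x", OF nz this]
  obtain g :: "'a \<Rightarrow> real" and \<epsilon>
    where g: "bounded_linear g" "\<epsilon> > 0" "\<And>m. \<epsilon> \<le> \<bar>g ((T ^^ m) x)\<bar>"
    by metis
  moreover have "g \<noteq> (\<lambda>_. 0)"
    using g(2) g(3)[of 0] by auto
  ultimately show ?thesis
    using that by blast
qed

end

section \<open>Non-density, the passage from \<open>S\<close> to \<open>- S\<close>, and complex
  scalars\<close>

lemma not_dense_if_constant_or_away_from_zero:
  fixes z :: "nat \<Rightarrow> 'b::real_normed_algebra_1"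
  assumes "(\<forall>m. z m = z 0) \<or> (\<exists>\<epsilon>>0. \<forall>m. \<epsilon> \<le> norm (z m))"
  shows "closure (range z) \<noteq> UNIV"
  using assms
proof
  assume "\<forall>m. z m = z 0"
  then have "closure (range z) \<subseteq> {z 0}"
    by (intro closure_minimal) auto
  then show ?thesis
    using zero_neq_one by (metis UNIV_I singletonD subsetD)
next
  assume "\<exists>\<epsilon>>0. \<forall>m. \<epsilon> \<le> norm (z m)"
  then obtain \<epsilon> where \<epsilon>: "\<epsilon> > 0" "\<And>m. \<epsilon> \<le> norm (z m)" by blast
  have "closed {w::'b. \<epsilon> \<le> norm w}"
    by (intro closed_Collect_le continuous_intros)
  then have "closure (range z) \<subseteq> {w. \<epsilon> \<le> norm w}"
    using \<epsilon>(2) by (intro closure_minimal) auto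
  then have "0 \<notin> closure (range z)"
    using \<epsilon>(1) by auto
  then show ?thesis by blast
qed

text \<open>The powers of \<open>- S\<close> and \<open>S\<close> differ by a sign, so the bound
  \<open>M\<close> carries over, and \<open>c S\<close> becomes \<open>- c R\<close>.\<close>

lemma power_bounded_uminus:
  fixes S :: "'a::real_normed_vector \<Rightarrow> 'a"
  assumes S: "bounded_linear S" and M: "\<And>n. onorm (S ^^ n) \<le> M" and "c > 0"
  shows "power_bounded (\<lambda>x. - S x) (\<lambda>x. (c + 1) *\<^sub>R x + c *\<^sub>R S x) c M"
proof (rule power_bounded.intro)
  interpret S: bounded_linear S by (rule S)
  show "linear (\<lambda>x. - S x)"
    by (intro linear_compose_neg S.linear)
  show "c > 0" by fact
  show "(c + 1) *\<^sub>R x + c *\<^sub>R S x = (1 + c) *\<^sub>R x - c *\<^sub>R - S x" for x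
    by (simp add: add.commute)
  have bl: "bounded_linear (S ^^ n)" for n
    by (induction n) (auto simp: o_def id_def intro: bounded_linear_compose[OF S] bounded_linear_ident)
  fix n x
  have "((\<lambda>x. - S x) ^^ n) x = (- 1) ^ n *\<^sub>R (S ^^ n) x"
    by (induction n) (simp_all add: S.scaleR)
  then have "norm (((\<lambda>x. - S x) ^^ n) x) = norm ((S ^^ n) x)"
    by simp
  also have "\<dots> \<le> onorm (S ^^ n) * norm x"
    by (rule onorm[OF bl])
  also have "\<dots> \<le> M * norm x"
    by (intro mult_right_mono M) simp
  finally show "norm (((\<lambda>x. - S x) ^^ n) x) \<le> M * norm x" .
qed

text \<open>The complex functional with real part \<open>g\<close> is
  \<open>g x - \<i> * g (\<i> x)\<close>, as in the complex Hahn-Banach theorem.\<close>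

lemma complexify_functional:
  fixes g :: "'a::real_normed_vector \<Rightarrow> real"
  assumes sc: "complex_scaling sc" and g: "bounded_linear g"
  defines "f \<equiv> \<lambda>x. Complex (g x) (- g (sc \<i> x))"
  shows "bounded_linear f" "complex_linear sc (*) f"
proof -
  interpret g: bounded_linear g by (rule g)
  have sc_add: "sc a (x + y) = sc a x + sc a y"
    and sc_mult: "sc a (sc b x) = sc (a * b) x"
    and sc_norm: "norm (sc a x) = cmod a * norm x"
    and sc_add_left: "sc (a + b) x = sc a x + sc b x"
    and sc_real: "sc (complex_of_real r) x = r *\<^sub>R x" for a b r x y
    using sc by (auto simp: complex_scaling_def)
  \<comment> \<open>The complex structure is determined by multiplication with \<open>\<i>\<close>,
    which reduces complex linearity to the real linearity of \<open>g\<close>.\<close>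
  have sc_eq: "sc a x = Re a *\<^sub>R x + Im a *\<^sub>R sc \<i> x" for a x
  proof -
    have "sc a x = sc (complex_of_real (Re a) + complex_of_real (Im a) * \<i>) x"
      by (subst complex_eq[of a]) (simp add: mult.commute)
    then show ?thesis
      by (simp only: sc_add_left sc_real sc_mult[symmetric])
  qed
  show lin: "complex_linear sc (*) f"
    unfolding complex_linear_def
  proof (intro allI)
    fix a x
    have "g (sc a x) = Re a * g x + Im a * g (sc \<i> x)"
      by (subst sc_eq) (simp add: g.add g.scaleR)
    moreover have "g (sc \<i> (sc a x)) = Re a * g (sc \<i> x) - Im a * g x"
      unfolding sc_mult by (subst sc_eq) (simp add: g.diff g.scaleR)
    ultimately show "f (sc a x) = a * f x"
      by (simp add: f_def complex_eq_iff)
  qed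
  obtain K where K: "\<And>x. norm (g x) \<le> norm x * K"
    using g.bounded by blast
  show "bounded_linear f"
  proof (rule bounded_linear_intro)
    show "f (x + y) = f x + f y" for x y
      by (simp add: f_def complex_eq_iff g.add sc_add)
    show "f (r *\<^sub>R x) = r *\<^sub>R f x" for r x
      using lin by (simp add: complex_linear_def flip: sc_real) (simp add: scaleR_conv_of_real)
    show "norm (f x) \<le> norm x * (2 * K)" for x
      using cmod_le[of "f x"] K[of x] K[of "sc \<i> x"] by (simp add: f_def sc_norm)
  qed
qed

theorem theorem5p5:
  fixes c :: real
  assumes "c > 0"
  shows "(\<forall>S :: 'a::banach \<Rightarrow> 'a.
            (\<exists>x::'a. x \<noteq> 0) \<and> bounded_linear S \<and> (\<exists>M. \<forall>n. onorm (S ^^ n) \<le> M) \<longrightarrow>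
            \<not> one_weakly_hypercyclic_real (\<lambda>x. (c + 1) *\<^sub>R x + c *\<^sub>R S x))
       \<and> (\<forall>(sc :: complex \<Rightarrow> 'b::banach \<Rightarrow> 'b) (S :: 'b \<Rightarrow> 'b).
            complex_scaling sc \<and> (\<exists>x::'b. x \<noteq> 0) \<and>
            bounded_linear S \<and> complex_linear sc sc S \<and> (\<exists>M. \<forall>n. onorm (S ^^ n) \<le> M) \<longrightarrow>
            \<not> one_weakly_hypercyclic_complex sc (\<lambda>x. (c + 1) *\<^sub>R x + c *\<^sub>R S x))"
proof (intro conjI allI impI)
  fix S :: "'a \<Rightarrow> 'a"
  assume S: "(\<exists>x::'a. x \<noteq> 0) \<and> bounded_linear S \<and> (\<exists>M. \<forall>n. onorm (S ^^ n) \<le> M)"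
  then obtain M where M: "\<And>n. onorm (S ^^ n) \<le> M" by blast
  define T where "T = (\<lambda>x. (c + 1) *\<^sub>R x + c *\<^sub>R S x)"
  interpret power_bounded "\<lambda>x. - S x" T c M
    unfolding T_def using S M assms by (intro power_bounded_uminus) auto
  have "\<exists>f :: 'a \<Rightarrow> real. bounded_linear f \<and> f \<noteq> (\<lambda>_. 0) \<and>
      closure (range (\<lambda>m. f ((T ^^ m) x))) \<noteq> UNIV" for x
  proof -
    obtain g :: "'a \<Rightarrow> real" where g: "bounded_linear g" "g \<noteq> (\<lambda>_. 0)"
      "T x = x \<or> (\<exists>\<epsilon>>0. \<forall>m. \<epsilon> \<le> \<bar>g ((T ^^ m) x)\<bar>)"
      using orbit_functional[of x] S by blast
    have "(T ^^ m) x = x" if "T x = x" for m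
      using that by (induction m) simp_all
    then have "closure (range (\<lambda>m. g ((T ^^ m) x))) \<noteq> UNIV"
      using g(3) by (intro not_dense_if_constant_or_away_from_zero) auto
    with g show ?thesis by blast
  qed
  then show "\<not> one_weakly_hypercyclic_real (\<lambda>x. (c + 1) *\<^sub>R x + c *\<^sub>R S x)"
    unfolding one_weakly_hypercyclic_real_def T_def[symmetric] by blast
next
  fix sc :: "complex \<Rightarrow> 'b \<Rightarrow> 'b" and S :: "'b \<Rightarrow> 'b"
  assume S: "complex_scaling sc \<and> (\<exists>x::'b. x \<noteq> 0) \<and> bounded_linear S \<and>
    complex_linear sc sc S \<and> (\<exists>M. \<forall>n. onorm (S ^^ n) \<le> M)"
  then obtain M where M: "\<And>n. onorm (S ^^ n) \<le> M" by blast
  define T where "T = (\<lambda>x. (c + 1) *\<^sub>R x + c *\<^sub>R S x)"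
  interpret power_bounded "\<lambda>x. - S x" T c M
    unfolding T_def using S M assms by (intro power_bounded_uminus) auto
  have "\<exists>f :: 'b \<Rightarrow> complex. bounded_linear f \<and> complex_linear sc (*) f \<and> f \<noteq> (\<lambda>_. 0) \<and>
      closure (range (\<lambda>m. f ((T ^^ m) x))) \<noteq> UNIV" for x
  proof -
    obtain g :: "'b \<Rightarrow> real" where g: "bounded_linear g" "g \<noteq> (\<lambda>_. 0)"
      "T x = x \<or> (\<exists>\<epsilon>>0. \<forall>m. \<epsilon> \<le> \<bar>g ((T ^^ m) x)\<bar>)"
      using orbit_functional[of x] S by blast
    define f where "f y = Complex (g y) (- g (sc \<i> y))" for y
    have f: "bounded_linear f" "complex_linear sc (*) f"
      unfolding f_def using complexify_functional[of sc g] S g(1) by auto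
    have Re_f: "Re (f y) = g y" for y
      by (simp add: f_def)
    then have nz: "f \<noteq> (\<lambda>_. 0)"
      using g(2) by (metis zero_complex.sel(1))
    have le: "\<bar>g y\<bar> \<le> norm (f y)" for y
      using abs_Re_le_cmod[of "f y"] by (simp add: Re_f)
    have "(T ^^ m) x = x" if "T x = x" for m
      using that by (induction m) simp_all
    \<comment> \<open>The same \<epsilon> works for \<open>f\<close>, since its modulus dominates
      that of its real part \<open>g\<close>.\<close>
    then have "(\<forall>m. f ((T ^^ m) x) = f ((T ^^ 0) x)) \<or> (\<exists>\<epsilon>>0. \<forall>m. \<epsilon> \<le> norm (f ((T ^^ m) x)))"
      using g(3) order_trans[OF _ le] by auto
    then have "closure (range (\<lambda>m. f ((T ^^ m) x))) \<noteq> UNIV"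
      by (rule not_dense_if_constant_or_away_from_zero)
    with f nz show ?thesis by blast
  qed
  then show "\<not> one_weakly_hypercyclic_complex sc (\<lambda>x. (c + 1) *\<^sub>R x + c *\<^sub>R S x)"
    unfolding one_weakly_hypercyclic_complex_def T_def[symmetric] by blast
qed

end
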